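(* Let $ABCD$ be a convex or re-entrant quadrangle in the Euclidean plane whose diagonals are not parallel, and let $S_{ABCD}$ be its area. Then for every $\lambda\in\mathbb{R}$ the area of the homothetic parallelogram $K^{\lambda}L^{\lambda}M^{\lambda}N^{\lambda}$ of $ABCD$ with ratio $\lambda$ equals $2(\lambda-1)^2S_{ABCD}$.
   Context: A quadrangle $ABCD$ consists of four points $A,B,C,D$ of the Euclidean plane, no three collinear, taken in this cyclic order; its sides are the segments $AB,BC,CD,DA$. It is convex, re-entrant (non-convex and not self-intersecting) or crossed (self-intersecting). In the convex and re-entrant cases $S_{ABCD}$ is the area of the region bounded by the sides. The lines $AC$ and $BD$ are its diagonals, and $O$ is their intersection point. For points $X,Y$ and $\lambda\in\mathbb{R}$, $X_Y^{\lambda}$ denotes the image of $Y$ under the homothety with center $X$ and ratio $\lambda$, i.e. $X_Y^{\lambda}=X+\lambda(Y-X)$. The homothetic parallelogram of $ABCD$ with ratio $\lambda$ is the parallelogram $K^{\lambda}L^{\lambda}M^{\lambda}N^{\lambda}$ whose vertices are the intersections of lines $K^{\lambda}=A_B^{\lambda}A_D^{\lambda}\cap B_A^{\lambda}B_C^{\lambda}$, $L^{\lambda}=B_A^{\lambda}B_C^{\lambda}\cap C_B^{\lambda}C_D^{\lambda}$, $M^{\lambda}=C_B^{\lambda}C_D^{\lambda}\cap D_A^{\lambda}D_C^{\lambda}$, $N^{\lambda}=D_A^{\lambda}D_C^{\lambda}\cap A_B^{\lambda}A_D^{\lambda}$. Convention for $\lambda=0$: the lines are understood as limits as $\lambda\to0$: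 $A_B^{0}A_D^{0}$ is the line through $A$ parallel to $BD$, $B_A^{0}B_C^{0}$ the line through $B$ parallel to $AC$, $C_B^{0}C_D^{0}$ the line through $C$ parallel to $BD$, $D_A^{0}D_C^{0}$ the line through $D$ parallel to $AC$. For $\lambda=1$ the parallelogram degenerates to the point $O$ (area $0$). *)

theory Defs
  imports "HOL-Analysis.Analysis"
begin

type_synonym point = "real^2"

definition quadrangle :: "point \<Rightarrow> point \<Rightarrow> point \<Rightarrow> point \<Rightarrow> bool" where
  "quadrangle A B C D \<longleftrightarrow>
     \<not> collinear {A, B, C} \<and> \<not> collinear {A, B, D} \<and>
     \<not> collinear {A, C, D} \<and> \<not> collinear {B, C, D}"

definition quad_sides :: "point \<Rightarrow> point \<Rightarrow> point \<Rightarrow> point \<Rightarrow> point set" where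
  "quad_sides A B C D =
     closed_segment A B \<union> closed_segment B C \<union> closed_segment C D \<union> closed_segment D A"

text \<open>The region is taken without its boundary. The boundary is a null set, so the area does
  not depend on this. The four points may be degenerate: if they coincide, the area is 0.\<close>

definition quad_region :: "point \<Rightarrow> point \<Rightarrow> point \<Rightarrow> point \<Rightarrow> point set" where
  "quad_region A B C D = inside (quad_sides A B C D)"

definition quad_area :: "point \<Rightarrow> point \<Rightarrow> point \<Rightarrow> point \<Rightarrow> real" where
  "quad_area A B C D = measure lebesgue (quad_region A B C D)"

text \<open>Since no three of the vertices are collinear, consecutive sides meet only in their common
  vertex, so self-intersection can only come from opposite sides.\<close>

definition crossed_quadrangle :: "point \<Rightarrow> point \<Rightarrow> point \<Rightarrow> point \<Rightarrow> bool" where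
  "crossed_quadrangle A B C D \<longleftrightarrow> quadrangle A B C D \<and>
     (closed_segment A B \<inter> closed_segment C D \<noteq> {} \<or>
      closed_segment B C \<inter> closed_segment D A \<noteq> {})"

definition convex_quadrangle :: "point \<Rightarrow> point \<Rightarrow> point \<Rightarrow> point \<Rightarrow> bool" where
  "convex_quadrangle A B C D \<longleftrightarrow> quadrangle A B C D \<and>
     \<not> crossed_quadrangle A B C D \<and> convex (quad_region A B C D)"

definition reentrant_quadrangle :: "point \<Rightarrow> point \<Rightarrow> point \<Rightarrow> point \<Rightarrow> bool" where
  "reentrant_quadrangle A B C D \<longleftrightarrow> quadrangle A B C D \<and>
     \<not> crossed_quadrangle A B C D \<and> \<not> convex (quad_region A B C D)"

definition homothety :: "point \<Rightarrow> real \<Rightarrow> point \<Rightarrow> point" where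
  "homothety X r Y = X + r *\<^sub>R (Y - X)"

text \<open>The line through the images of \<open>Y\<close> and \<open>Z\<close> under the homothety with center \<open>X\<close> and ratio
  \<open>r\<close>. For \<open>r = 0\<close> both images are \<open>X\<close>, and the line is by convention the limit as \<open>r\<close> tends
  to 0: the parallel to \<open>YZ\<close> through \<open>X\<close>.\<close>

definition hom_line :: "real \<Rightarrow> point \<Rightarrow> point \<Rightarrow> point \<Rightarrow> point set" where
  "hom_line r X Y Z =
     (if r = 0 then {X + t *\<^sub>R (Z - Y) | t. True}
      else affine hull {homothety X r Y, homothety X r Z})"

text \<open>\<^term>\<open>the_elem S\<close> is the element of \<open>S\<close> if \<open>S\<close> is a singleton, and unspecified otherwise.\<close>

definition hom_K :: "real \<Rightarrow> point \<Rightarrow> point \<Rightarrow> point \<Rightarrow> point \<Rightarrow> point" where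
  "hom_K r A B C D = the_elem (hom_line r A B D \<inter> hom_line r B A C)"

definition hom_L :: "real \<Rightarrow> point \<Rightarrow> point \<Rightarrow> point \<Rightarrow> point \<Rightarrow> point" where
  "hom_L r A B C D = the_elem (hom_line r B A C \<inter> hom_line r C B D)"

definition hom_M :: "real \<Rightarrow> point \<Rightarrow> point \<Rightarrow> point \<Rightarrow> point \<Rightarrow> point" where
  "hom_M r A B C D = the_elem (hom_line r C B D \<inter> hom_line r D A C)"

definition hom_N :: "real \<Rightarrow> point \<Rightarrow> point \<Rightarrow> point \<Rightarrow> point \<Rightarrow> point" where
  "hom_N r A B C D = the_elem (hom_line r D A C \<inter> hom_line r A B D)"

end

(* One of the diagonals of an uncrossed quadrangle cuts it into two triangles lying on opposite sides of that
   diagonal, so the area is half the absolute value of the cross product of the diagonal vectors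
   p = C - A and q = D - B. The sides of the homothetic parallelogram are parallel to p and q; two
   opposite ones are carried to each other by the translation along (1 - r) p, respectively
   (1 - r) q. Its area is therefore (1 - r)^2 times the absolute cross product of p and q. *)
theory Submission
  imports Defs
begin

section \<open>Orientation and barycentric coordinates\<close>

text \<open>Twice the signed area of the triangle, positive when \<open>X\<close>, \<open>Y\<close>,
  \<open>Z\<close> run counterclockwise.\<close>

definition orient :: "point \<Rightarrow> point \<Rightarrow> point \<Rightarrow> real" where
  "orient X Y Z = (Y $ 1 - X $ 1) * (Z $ 2 - X $ 2) - (Y $ 2 - X $ 2) * (Z $ 1 - X $ 1)"

lemma orient_eq_0_imp_collinear:
  assumes "orient X Y Z = 0"
  shows "collinear {X, Y, Z}"
proof (cases "Y = X")
  case True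
  then show ?thesis by simp
next
  case False
  have "\<exists>c. Z - X = c *\<^sub>R (Y - X)"
  proof (cases "Y $ 1 = X $ 1")
    case True
    with False have "Y $ 2 \<noteq> X $ 2" by (auto simp: vec_eq_iff forall_2)
    with True assms have "Z - X = ((Z $ 2 - X $ 2) / (Y $ 2 - X $ 2)) *\<^sub>R (Y - X)"
      by (auto simp: vec_eq_iff forall_2 orient_def)
    then show ?thesis ..
  next
    case False
    with assms have "Z - X = ((Z $ 1 - X $ 1) / (Y $ 1 - X $ 1)) *\<^sub>R (Y - X)"
      by (simp add: vec_eq_iff forall_2 orient_def eq_divide_eq mult.commute)
    then show ?thesis ..
  qed
  then have "collinear {0, Y - X, Z - X}"
    by (simp add: collinear_lemma)
  then have "collinear {Y, X, Z}"
    by (simp add: collinear_3)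
  then show ?thesis by (simp add: insert_commute)
qed

lemma orient_rotate: "orient Y Z X = orient X Y Z"
  by (simp add: orient_def algebra_simps)

lemma orient_swap: "orient X Z Y = - orient X Y Z"
  by (simp add: orient_def algebra_simps)

text \<open>Both sums expand to the cross product of the diagonals \<open>C - A\<close> and
  \<open>D - B\<close>, so either diagonal may be used for cutting.\<close>

lemma orient_split: "orient A B C + orient A C D = orient B C D + orient B D A"
  by (simp add: orient_def algebra_simps)

lemma open_orient_pos: "open {x. 0 < orient X Y x}"
  unfolding orient_def by (intro open_Collect_less continuous_intros)

text \<open>\<open>orient A B\<close> is affine in its last argument and vanishes at
  \<open>A\<close> and \<open>B\<close>, so only the weight of \<open>C\<close> survives; the other
  two cases are cyclic.\<close>

lemma orient_barycentric:
  assumes "u + v + w = 1"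
  shows "orient A B (u *\<^sub>R A + v *\<^sub>R B + w *\<^sub>R C) = w * orient A B C"
    and "orient B C (u *\<^sub>R A + v *\<^sub>R B + w *\<^sub>R C) = u * orient A B C"
    and "orient C A (u *\<^sub>R A + v *\<^sub>R B + w *\<^sub>R C) = v * orient A B C"
proof -
  have u: "u = 1 - v - w" using assms by simp
  show "orient A B (u *\<^sub>R A + v *\<^sub>R B + w *\<^sub>R C) = w * orient A B C"
    and "orient B C (u *\<^sub>R A + v *\<^sub>R B + w *\<^sub>R C) = u * orient A B C"
    and "orient C A (u *\<^sub>R A + v *\<^sub>R B + w *\<^sub>R C) = v * orient A B C"
    unfolding u orient_def by (simp_all, algebra+)
qed

text \<open>Cramer's rule: the weight of a vertex is the signed area spanned by \<open>x\<close> and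
  the opposite edge, relative to the whole triangle.\<close>

lemma barycentric_orient:
  assumes "orient A B C \<noteq> 0"
  shows "x = (orient B C x / orient A B C) *\<^sub>R A + (orient C A x / orient A B C) *\<^sub>R B
             + (orient A B x / orient A B C) *\<^sub>R C"
    and "orient B C x / orient A B C + orient C A x / orient A B C + orient A B x / orient A B C = 1"
proof -
  have "orient A B C * x $ i = orient B C x * A $ i + orient C A x * B $ i + orient A B x * C $ i" for i
    using exhaust_2[of i] by (auto simp: orient_def algebra_simps)
  with assms show "x = (orient B C x / orient A B C) *\<^sub>R A + (orient C A x / orient A B C) *\<^sub>R B
             + (orient A B x / orient A B C) *\<^sub>R C"
    by (simp add: vec_eq_iff divide_simps mult.commute)
  have "orient B C x + orient C A x + orient A B x = orient A B C"
    by (simp add: orient_def algebra_simps)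
  with assms show "orient B C x / orient A B C + orient C A x / orient A B C
      + orient A B x / orient A B C = 1"
    by (simp add: divide_simps)
qed

lemma in_triangle_iff:
  assumes "0 < orient A B C"
  shows "x \<in> convex hull {A, B, C} \<longleftrightarrow> 0 \<le> orient A B x \<and> 0 \<le> orient B C x \<and> 0 \<le> orient C A x"
proof
  assume "x \<in> convex hull {A, B, C}"
  with assms show "0 \<le> orient A B x \<and> 0 \<le> orient B C x \<and> 0 \<le> orient C A x"
    by (auto simp: convex_hull_3 orient_barycentric)
next
  assume *: "0 \<le> orient A B x \<and> 0 \<le> orient B C x \<and> 0 \<le> orient C A x"
  have "\<exists>u v w. x = u *\<^sub>R A + v *\<^sub>R B + w *\<^sub>R C \<and> 0 \<le> u \<and> 0 \<le> v \<and> 0 \<le> w \<and> u + v + w = 1"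
    using barycentric_orient[of A B C x] assms *
    by (intro exI[of _ "orient B C x / orient A B C"] exI[of _ "orient C A x / orient A B C"]
        exI[of _ "orient A B x / orient A B C"]) auto
  then show "x \<in> convex hull {A, B, C}" by (auto simp: convex_hull_3)
qed

lemma triangle_edge:
  assumes "0 < orient A B C" "x \<in> convex hull {A, B, C}" "orient A B x = 0"
  shows "x \<in> closed_segment A B"
proof -
  obtain u v w where x: "x = u *\<^sub>R A + v *\<^sub>R B + w *\<^sub>R C" "0 \<le> u" "0 \<le> v" "0 \<le> w" "u + v + w = 1"
    using assms(2) by (auto simp: convex_hull_3)
  with assms have "w = 0" by (auto simp: orient_barycentric)
  with x have "x = (1 - v) *\<^sub>R A + v *\<^sub>R B" "v \<le> 1" by auto
  with x show ?thesis by (auto simp: in_segment)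
qed

section \<open>Region and area of a quadrangle cut by a diagonal\<close>

text \<open>Let \<open>?R\<close> be the union of the two triangles. Its complement is connected,
  unbounded and disjoint from the sides, hence outside them. Conversely, points of \<open>?R\<close>
  off the sides are interior to \<open>?R\<close>, so the frontier of \<open>?R\<close> consists of
  points on the sides and encloses them.\<close>

lemma quad_region_eq_split:
  assumes "0 < orient A B C" "0 < orient A C D"
  shows "quad_region A B C D = convex hull {A, B, C} \<union> convex hull {A, C, D} - quad_sides A B C D"
    (is "_ = ?R - ?P")
proof
  let ?S = "convex hull {A, B, C}" and ?T = "convex hull {A, C, D}"
  have S: "x \<in> ?S \<longleftrightarrow> 0 \<le> orient A B x \<and> 0 \<le> orient B C x \<and> 0 \<le> orient C A x" for x
    using in_triangle_iff assms by blast
  have T: "x \<in> ?T \<longleftrightarrow> 0 \<le> orient A C x \<and> 0 \<le> orient C D x \<and> 0 \<le> orient D A x" for x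
    using in_triangle_iff assms by blast
  have AC: "orient A C x = - orient C A x" for x
    by (metis orient_rotate orient_swap)
  have comp: "compact ?S" "compact ?T"
    by (simp_all add: finite_imp_compact_convex_hull)
  have ne: "A \<in> ?S \<inter> ?T" by (simp add: hull_inc)
  \<comment> \<open>Two compact convex sets with a common point form an absolute retract, so the complement of their
    union is connected.\<close>
  have "AR (?S \<union> ?T)"
  proof (rule AR_closed_Un)
    show "AR (?S \<inter> ?T)" using ne by (intro convex_imp_AR convex_Int) auto
  qed (use comp ne compact_imp_closed in \<open>auto intro!: convex_imp_AR\<close>)
  then have "connected (- ?R)"
    using comp by (intro connected_complement_absolute_retract) auto
  moreover have bR: "bounded ?R" using comp compact_imp_bounded by blast
  then have "\<not> bounded (- ?R)" by (simp add: cobounded_imp_unbounded)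
  moreover have "?P \<subseteq> ?R"
    unfolding quad_sides_def segment_convex_hull
    by (intro Un_least) (auto intro: subsetD[OF hull_mono, rotated])
  then have "?R - ?P \<union> - ?R = - ?P" by blast
  ultimately show "quad_region A B C D \<subseteq> ?R - ?P"
    unfolding quad_region_def by (rule inside_subset)
  have edgeS: "0 < orient A B x \<and> 0 < orient B C x" if "x \<in> ?S" "x \<notin> ?P" for x
  proof -
    have "orient A B x \<noteq> 0" using that triangle_edge[OF assms(1)] by (auto simp: quad_sides_def)
    moreover have "orient B C x \<noteq> 0" using that triangle_edge[of B C A x] assms(1)
      by (auto simp: quad_sides_def orient_rotate insert_commute)
    ultimately show ?thesis using that S[of x] by auto
  qed
  have edgeT: "0 < orient C D x \<and> 0 < orient D A x" if "x \<in> ?T" "x \<notin> ?P" for x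
  proof -
    have "orient C D x \<noteq> 0" using that triangle_edge[of C D A x] assms(2)
      by (auto simp: quad_sides_def orient_rotate insert_commute)
    moreover have "orient D A x \<noteq> 0" using that triangle_edge[of D A C x] assms(2)
      by (auto simp: quad_sides_def orient_rotate insert_commute)
    ultimately show ?thesis using that T[of x] by auto
  qed
  have diagS: "x \<in> ?T" if "x \<in> ?S" "orient C A x = 0" for x
  proof -
    have "x \<in> closed_segment C A" using that triangle_edge[of C A B x] assms(1)
      by (auto simp: orient_rotate insert_commute)
    then show ?thesis unfolding segment_convex_hull
      by (rule subsetD[OF hull_mono, rotated]) auto
  qed
  have diagT: "x \<in> ?S" if "x \<in> ?T" "orient C A x = 0" for x
  proof -
    have "x \<in> closed_segment A C" using that triangle_edge[of A C D x] assms(2) AC[of x]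
      by auto
    then show ?thesis unfolding segment_convex_hull
      by (rule subsetD[OF hull_mono, rotated]) auto
  qed
  \<comment> \<open>\<open>U\<close> and \<open>V\<close> are the open triangles. \<open>W\<close>
    serves the points on the open diagonal: it puts no condition on the side of \<open>AC\<close>,
    and each of its points falls into the triangle on its own side. With a reflex angle at
    \<open>A\<close> or \<open>C\<close>, \<open>W\<close> misses part of the interior, which
    \<open>U\<close> and \<open>V\<close> supply.\<close>
  define U where "U = {x. 0 < orient A B x} \<inter> {x. 0 < orient B C x} \<inter> {x. 0 < orient C A x}"
  define V where "V = {x. 0 < orient A C x} \<inter> {x. 0 < orient C D x} \<inter> {x. 0 < orient D A x}"
  define W where "W = {x. 0 < orient A B x} \<inter> {x. 0 < orient B C x} \<inter> {x. 0 < orient C D x}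
    \<inter> {x. 0 < orient D A x}"
  have "open (U \<union> V \<union> W)"
    unfolding U_def V_def W_def by (intro open_Un open_Int open_orient_pos)
  moreover have "U \<union> V \<union> W \<subseteq> ?R"
    using S T AC by (force simp: U_def V_def W_def)
  ultimately have int: "U \<union> V \<union> W \<subseteq> interior ?R" by (rule interior_maximal[rotated])
  have "x \<in> U \<union> V \<union> W" if "x \<in> ?R" "x \<notin> ?P" for x
  proof (cases "orient C A x = 0")
    case True
    then have "x \<in> ?S" "x \<in> ?T" using that diagS diagT by auto
    with that show ?thesis using edgeS[of x] edgeT[of x] by (auto simp: W_def)
  next
    case False
    with that show ?thesis using edgeS[of x] edgeT[of x] S[of x] T[of x] AC[of x]
      by (auto simp: U_def V_def)
  qed
  with int have *: "?R - ?P \<subseteq> interior ?R" by blast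
  have "closed ?R" using comp compact_imp_closed by blast
  with * have "frontier ?R \<subseteq> ?P" by (auto simp: frontier_def)
  \<comment> \<open>The interior of a bounded set lies inside its frontier; enlarging the frontier
    to \<open>?P\<close> keeps the points off \<open>?P\<close> inside.\<close>
  then have "inside (frontier ?R) - ?P \<subseteq> inside ?P" by (rule inside_mono)
  with * interior_inside_frontier[OF bR] show "?R - ?P \<subseteq> quad_region A B C D"
    unfolding quad_region_def by blast
qed

lemma quad_area_split_pos:
  assumes "0 < orient A B C" "0 < orient A C D"
  shows "quad_area A B C D = (orient A B C + orient A C D) / 2"
proof -
  let ?S = "convex hull {A, B, C}" and ?T = "convex hull {A, C, D}" and ?P = "quad_sides A B C D"
  have "?S \<in> sets lborel" "?T \<in> sets lborel"
    by (simp_all add: borel_compact finite_imp_compact_convex_hull)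
  then have mS: "measure lebesgue ?S = orient A B C / 2" and mT: "measure lebesgue ?T = orient A C D / 2"
    using assms content_triangle[of A B C] content_triangle[of A C D]
    by (simp_all add: orient_def abs_if algebra_simps split: if_splits)
  have lm: "?S \<in> lmeasurable" "?T \<in> lmeasurable"
    by (auto intro!: lmeasurable_compact finite_imp_compact_convex_hull)
  \<comment> \<open>Convex sets have null frontiers, and those of the two triangles contain all four
    sides and the diagonal. This disposes both of the removed boundary and of the overlap of the
    triangles.\<close>
  have neg: "negligible (frontier ?S \<union> frontier ?T)"
    by (simp add: negligible_convex_frontier)
  have fr: "frontier ?S = closed_segment A B \<union> closed_segment B C \<union> closed_segment C A"
    "frontier ?T = closed_segment A C \<union> closed_segment C D \<union> closed_segment D A"
    by (simp_all add: frontier_of_triangle)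
  have "negligible ?P"
    using neg by (rule negligible_subset) (auto simp: fr quad_sides_def)
  then have "measure lebesgue (?S \<union> ?T - ?P) = measure lebesgue (?S \<union> ?T)"
    using lm by (intro measure_negligible_symdiff) (auto intro: negligible_subset)
  moreover have "?S \<inter> ?T \<subseteq> closed_segment A C"
  proof
    fix x assume x: "x \<in> ?S \<inter> ?T"
    have "orient A C x = - orient C A x"
      by (metis orient_rotate orient_swap)
    with x have "orient A C x = 0"
      using in_triangle_iff assms by fastforce
    with x assms(2) show "x \<in> closed_segment A C" using triangle_edge by blast
  qed
  then have "negligible (?S \<inter> ?T)"
    by (intro negligible_subset[OF neg]) (auto simp: fr)
  then have "measure lebesgue (?S \<union> ?T) = measure lebesgue ?S + measure lebesgue ?T"
    using lm by (simp add: measure_Un3 negligible_imp_measure0)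
  ultimately show ?thesis
    unfolding quad_area_def quad_region_eq_split[OF assms] mS mT by simp
qed

lemma quad_area_split:
  assumes "0 < orient A B C * orient A C D"
  shows "quad_area A B C D = \<bar>orient A B C + orient A C D\<bar> / 2"
proof (cases "0 < orient A B C")
  case True
  with assms show ?thesis by (simp add: quad_area_split_pos zero_less_mult_iff)
next
  case False
  \<comment> \<open>Traversing the vertices backwards keeps the sides and makes both orientations
    positive.\<close>
  have "quad_sides A B C D = quad_sides A D C B"
    by (auto simp: quad_sides_def closed_segment_commute)
  then have "quad_area A B C D = quad_area A D C B"
    by (simp add: quad_area_def quad_region_def)
  with False assms show ?thesis
    by (simp add: quad_area_split_pos zero_less_mult_iff orient_swap[of A C D]
        orient_swap[of A B C])
qed

lemma quad_area_rotate: "quad_area B C D A = quad_area A B C D"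
proof -
  have "quad_sides B C D A = quad_sides A B C D"
    by (auto simp: quad_sides_def)
  then show ?thesis by (simp add: quad_area_def quad_region_def)
qed

section \<open>Uncrossed quadrangles and their separating diagonal\<close>

text \<open>After division by the common coefficient sum, both sides are convex combinations, that
  is, one point on both segments.\<close>

lemma segments_meet:
  fixes X Y Z W :: "'a::real_vector"
  assumes "a *\<^sub>R X + b *\<^sub>R Y = c *\<^sub>R Z + d *\<^sub>R W" "a + b = c + d"
    and "0 < a" "0 < b" "0 < c" "0 < d"
  shows "closed_segment X Y \<inter> closed_segment Z W \<noteq> {}"
proof -
  define p where "p = (1 / (a + b)) *\<^sub>R (a *\<^sub>R X + b *\<^sub>R Y)"
  have "p = (1 - b / (a + b)) *\<^sub>R X + (b / (a + b)) *\<^sub>R Y"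
    using assms(3,4) by (simp add: p_def scaleR_add_right divide_simps)
  then have "p \<in> closed_segment X Y"
    using assms by (auto simp: in_segment intro!: exI[of _ "b / (a + b)"])
  moreover have "p = (1 - d / (c + d)) *\<^sub>R Z + (d / (c + d)) *\<^sub>R W"
    unfolding p_def assms(1,2) using assms(5,6) by (simp add: scaleR_add_right divide_simps)
  then have "p \<in> closed_segment Z W"
    using assms by (auto simp: in_segment intro!: exI[of _ "d / (c + d)"])
  ultimately show ?thesis by blast
qed

text \<open>With all four coefficients nonzero, two of one sign and two of the other, moving terms of one
  sign to one side turns this dependence into a common point of two segments.\<close>
lemma orient_affine_dependence:
  "orient B C D *\<^sub>R A + orient A B D *\<^sub>R C = orient A C D *\<^sub>R B + orient A B C *\<^sub>R D"
  "orient B C D + orient A B D = orient A C D + orient A B C"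
  by (simp_all add: vec_eq_iff forall_2 orient_def algebra_simps)

text \<open>A positive product says that the diagonal separates the other two vertices. If neither
  diagonal did, the signs in the affine dependence of the four points would force a pair of opposite
  sides to meet.\<close>

lemma uncrossed_diagonal:
  assumes "quadrangle A B C D" "\<not> crossed_quadrangle A B C D"
  shows "0 < orient A B C * orient A C D \<or> 0 < orient B C D * orient B D A"
proof (rule ccontr)
  let ?a = "orient B C D" and ?b = "orient A C D" and ?c = "orient A B D" and ?d = "orient A B C"
  assume "\<not> ?thesis"
  moreover have nz: "?a \<noteq> 0" "?b \<noteq> 0" "?c \<noteq> 0" "?d \<noteq> 0"
    using assms(1) orient_eq_0_imp_collinear unfolding quadrangle_def by blast+
  moreover have "orient B D A = ?c" by (rule orient_rotate)
  ultimately have "?a * ?c < 0" "?d * ?b < 0"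
    by (auto simp: not_less less_le)
  then have signs: "(0 < ?a \<and> ?c < 0 \<or> ?a < 0 \<and> 0 < ?c) \<and> (0 < ?d \<and> ?b < 0 \<or> ?d < 0 \<and> 0 < ?b)"
    by (auto simp: mult_less_0_iff)
  note dep = orient_affine_dependence[of B C D A]
  have disj: "closed_segment A B \<inter> closed_segment C D = {}"
    "closed_segment B C \<inter> closed_segment D A = {}"
    using assms by (auto simp: crossed_quadrangle_def)
  \<comment> \<open>One rearrangement for each of the four sign patterns, with all coefficients
    positive in that pattern: the first two make \<open>AB\<close> meet \<open>CD\<close>, the last
    two \<open>BC\<close> meet \<open>DA\<close>.\<close>
  have 1: "?a *\<^sub>R A + (- ?b) *\<^sub>R B = (- ?c) *\<^sub>R C + ?d *\<^sub>R D"
    "(- ?a) *\<^sub>R A + ?b *\<^sub>R B = ?c *\<^sub>R C + (- ?d) *\<^sub>R D"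
    "?b *\<^sub>R B + (- ?c) *\<^sub>R C = (- ?d) *\<^sub>R D + ?a *\<^sub>R A"
    "(- ?b) *\<^sub>R B + ?c *\<^sub>R C = ?d *\<^sub>R D + (- ?a) *\<^sub>R A"
    using dep(1) by (simp_all add: algebra_simps)
  show False
    using signs disj segments_meet[OF 1(1)] segments_meet[OF 1(2)] segments_meet[OF 1(3)]
      segments_meet[OF 1(4)] dep(2) by auto
qed

text \<open>Two terms of equal sign cannot cancel, whence the first claim. If \<open>BD\<close> is
  the separating diagonal, rotating the vertices and \<open>orient_split\<close> lead back to the
  expression for \<open>AC\<close>.\<close>

lemma quad_area_uncrossed:
  assumes "quadrangle A B C D" "\<not> crossed_quadrangle A B C D"
  shows "orient A B C + orient A C D \<noteq> 0"
    and "quad_area A B C D = \<bar>orient A B C + orient A C D\<bar> / 2"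
proof -
  have "orient A B C + orient A C D \<noteq> 0
    \<and> quad_area A B C D = \<bar>orient A B C + orient A C D\<bar> / 2"
    using uncrossed_diagonal[OF assms]
  proof
    assume "0 < orient A B C * orient A C D"
    then show ?thesis using quad_area_split by (auto simp: zero_less_mult_iff)
  next
    assume *: "0 < orient B C D * orient B D A"
    then have "orient B C D + orient B D A \<noteq> 0" by (auto simp: zero_less_mult_iff)
    with quad_area_split[OF *] show ?thesis
      by (simp add: orient_split[of A B C D] quad_area_rotate[where A = A])
  qed
  then show "orient A B C + orient A C D \<noteq> 0"
    and "quad_area A B C D = \<bar>orient A B C + orient A C D\<bar> / 2" by auto
qed

section \<open>Vertices of the homothetic parallelogram\<close>

definition cross2 :: "point \<Rightarrow> point \<Rightarrow> real" where
  "cross2 p q = p $ 1 * q $ 2 - p $ 2 * q $ 1"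

text \<open>The images of \<open>Y\<close> and \<open>Z\<close> differ by
  \<open>r *\<^sub>R (Z - Y)\<close>, so the direction is \<open>Z - Y\<close> for all nonzero
  \<open>r\<close>; the convention at 0 fits the same formula, which spares later case
  distinctions.\<close>

lemma hom_line_param:
  "hom_line r X Y Z = {X + r *\<^sub>R (Y - X) + t *\<^sub>R (Z - Y) | t. True}"
proof (cases "r = 0")
  case True
  then show ?thesis by (simp add: hom_line_def)
next
  case False
  have "affine hull {homothety X r Y, homothety X r Z}
      = range (\<lambda>u. X + r *\<^sub>R (Y - X) + (u * r) *\<^sub>R (Z - Y))"
    by (simp add: affine_hull_2_alt homothety_def algebra_simps)
  also have "\<dots> = (\<lambda>t. X + r *\<^sub>R (Y - X) + t *\<^sub>R (Z - Y)) ` range (\<lambda>u. u * r)"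
    by (simp add: image_image)
  also have "range (\<lambda>u. u * r) = UNIV"
    using False by (metis surj_def nonzero_divide_eq_eq)
  finally show ?thesis using False by (auto simp: hom_line_def)
qed

text \<open>Makes the intersection a singleton, so that \<open>the_elem\<close> is determined. Both
  orders appear because the vertices alternately name the two directions first.\<close>

lemma lines_meet_unique:
  assumes "cross2 p q \<noteq> 0" "x \<in> {P + t *\<^sub>R p | t. True}" "x \<in> {Q + t *\<^sub>R q | t. True}"
  shows "the_elem ({P + t *\<^sub>R p | t. True} \<inter> {Q + t *\<^sub>R q | t. True}) = x"
    and "the_elem ({Q + t *\<^sub>R q | t. True} \<inter> {P + t *\<^sub>R p | t. True}) = x"
proof -
  obtain a where a: "x = P + a *\<^sub>R p" using assms(2) by blast
  obtain b where b: "x = Q + b *\<^sub>R q" using assms(3) by blast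
  have "y = x" if "y = P + s *\<^sub>R p" "y = Q + t *\<^sub>R q" for y s t
  proof -
    have "(s - a) *\<^sub>R p = y - x" unfolding that(1) a by (simp add: algebra_simps)
    also have "\<dots> = (t - b) *\<^sub>R q" unfolding that(2) b by (simp add: algebra_simps)
    finally have "(s - a) *\<^sub>R p = (t - b) *\<^sub>R q" .
    then have "(s - a) * p $ 1 = (t - b) * q $ 1" "(s - a) * p $ 2 = (t - b) * q $ 2"
      by (simp_all add: vec_eq_iff forall_2)
    \<comment> \<open>Taking the cross product with \<open>q\<close> kills the right-hand
      side.\<close>
    then have "(s - a) * cross2 p q = 0" unfolding cross2_def by algebra
    with assms(1) that(1) a show ?thesis by simp
  qed
  with assms(2,3) have "{P + t *\<^sub>R p | t. True} \<inter> {Q + t *\<^sub>R q | t. True} = {x}" by blast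
  then show "the_elem ({P + t *\<^sub>R p | t. True} \<inter> {Q + t *\<^sub>R q | t. True}) = x"
    and "the_elem ({Q + t *\<^sub>R q | t. True} \<inter> {P + t *\<^sub>R p | t. True}) = x"
    by (simp_all add: Int_commute)
qed

lemma cross2_decompose:
  assumes "cross2 p q \<noteq> 0"
  obtains a b where "v = a *\<^sub>R p + b *\<^sub>R q"
proof
  have "cross2 p q * v $ i = cross2 v q * p $ i + cross2 p v * q $ i" for i
    using exhaust_2[of i] by (auto simp: cross2_def algebra_simps)
  with assms show "v = (cross2 v q / cross2 p q) *\<^sub>R p + (cross2 p v / cross2 p q) *\<^sub>R q"
    by (simp add: vec_eq_iff divide_simps mult.commute)
qed

lemma hom_parallelogram:
  assumes "cross2 (C - A) (D - B) \<noteq> 0"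
  obtains K where "hom_K r A B C D = K" "hom_L r A B C D = K + (1 - r) *\<^sub>R (C - A)"
    "hom_M r A B C D = K + (1 - r) *\<^sub>R (C - A) + (1 - r) *\<^sub>R (D - B)"
    "hom_N r A B C D = K + (1 - r) *\<^sub>R (D - B)"
proof -
  define p q where "p = C - A" and "q = D - B"
  have pq: "cross2 p q \<noteq> 0" using assms by (simp add: p_def q_def)
  \<comment> \<open>The left-hand side is \<open>P - Q\<close> for the base points of the first two
    lines, so \<open>Q + a *\<^sub>R p\<close> and \<open>P - b *\<^sub>R q\<close> are the same
    point, their intersection \<open>K\<close>.\<close>
  obtain a b where ab: "(1 - 2 * r) *\<^sub>R (A - B) = a *\<^sub>R p + b *\<^sub>R q"
    using cross2_decompose[OF pq] .
  define P Q where "P = A + r *\<^sub>R (B - A)" and "Q = B + r *\<^sub>R (A - B)"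
  define K where "K = Q + a *\<^sub>R p"
  have "P - Q = (1 - 2 * r) *\<^sub>R (A - B)"
    by (simp add: P_def Q_def algebra_simps scaleR_2[symmetric])
  then have K: "K = P + (- b) *\<^sub>R q"
    unfolding ab K_def by (simp add: algebra_simps)
  \<comment> \<open>Images of the same point under homotheties of ratio \<open>r\<close> differ by
    \<open>1 - r\<close> times the difference of the centers; here \<open>B\<close> is seen from
    \<open>C\<close> and \<open>A\<close>, and \<open>A\<close> from \<open>D\<close> and
    \<open>B\<close>.\<close>
  have P': "C + r *\<^sub>R (B - C) = P + (1 - r) *\<^sub>R p"
    and Q': "D + r *\<^sub>R (A - D) = Q + (1 - r) *\<^sub>R q"
    by (simp_all add: P_def Q_def p_def q_def algebra_simps)
  have lines: "hom_line r A B D = {P + t *\<^sub>R q | t. True}" "hom_line r B A C = {Q + t *\<^sub>R p | t. True}"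
    "hom_line r C B D = {P + (1 - r) *\<^sub>R p + t *\<^sub>R q | t. True}"
    "hom_line r D A C = {Q + (1 - r) *\<^sub>R q + t *\<^sub>R p | t. True}"
    unfolding hom_line_param P' Q' by (simp_all add: P_def Q_def p_def q_def)
  have 1: "K + s *\<^sub>R q \<in> {P + t *\<^sub>R q | t. True}" for s
    using K by (auto simp: algebra_simps intro!: exI[of _ "s - b"])
  have 2: "K + s *\<^sub>R p \<in> {Q + t *\<^sub>R p | t. True}" for s
    by (auto simp: K_def algebra_simps intro!: exI[of _ "s + a"])
  have 3: "K + (1 - r) *\<^sub>R p + s *\<^sub>R q \<in> {P + (1 - r) *\<^sub>R p + t *\<^sub>R q | t. True}" for s
    using K by (auto simp: algebra_simps intro!: exI[of _ "s - b"])
  have 4: "K + s *\<^sub>R p + (1 - r) *\<^sub>R q \<in> {Q + (1 - r) *\<^sub>R q + t *\<^sub>R p | t. True}" for s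
    by (auto simp: K_def algebra_simps intro!: exI[of _ "s + a"])
  show thesis
  proof
    show "hom_K r A B C D = K"
      unfolding hom_K_def lines using 1[of 0] 2[of 0] by (intro lines_meet_unique pq) simp_all
    show "hom_L r A B C D = K + (1 - r) *\<^sub>R (C - A)"
      unfolding hom_L_def lines p_def[symmetric] using 2 3[of 0]
      by (intro lines_meet_unique pq) simp_all
    show "hom_M r A B C D = K + (1 - r) *\<^sub>R (C - A) + (1 - r) *\<^sub>R (D - B)"
      unfolding hom_M_def lines p_def[symmetric] q_def[symmetric]
      by (intro lines_meet_unique pq 3 4)
    show "hom_N r A B C D = K + (1 - r) *\<^sub>R (D - B)"
      unfolding hom_N_def lines q_def[symmetric] using 1 4[of 0]
      by (intro lines_meet_unique pq) simp_all
  qed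
qed

section \<open>Area of the parallelogram and conclusion\<close>

text \<open>The diagonal from \<open>K\<close> to \<open>K + p + q\<close> cuts off two triangles,
  both of orientation \<open>cross2 p q\<close>.\<close>

lemma quad_area_parallelogram:
  "quad_area K (K + p) (K + p + q) (K + q) = \<bar>cross2 p q\<bar>"
  if "cross2 p q \<noteq> 0"
proof -
  have "orient K (K + p) (K + p + q) = cross2 p q" "orient K (K + p + q) (K + q) = cross2 p q"
    by (simp_all add: orient_def cross2_def algebra_simps)
  with that quad_area_split[of K "K + p" "K + p + q" "K + q"] show ?thesis
    by (simp add: zero_less_mult_iff neq_iff disj_commute)
qed

lemma quad_area_singleton: "quad_area K K K K = 0"
  by (simp add: quad_area_def quad_region_def quad_sides_def)

theorem mainTheorem3:
  fixes A B C D :: "real^2" and r :: real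
  assumes "convex_quadrangle A B C D \<or> reentrant_quadrangle A B C D"
    and "\<not> affine_parallel (affine hull {A, C}) (affine hull {B, D})"
  shows "quad_area (hom_K r A B C D) (hom_L r A B C D) (hom_M r A B C D) (hom_N r A B C D)
         = 2 * (r - 1)\<^sup>2 * quad_area A B C D"
proof -
  have uncrossed: "quadrangle A B C D" "\<not> crossed_quadrangle A B C D"
    using assms(1) by (auto simp: convex_quadrangle_def reentrant_quadrangle_def)
  have diag: "orient A B C + orient A C D = cross2 (C - A) (D - B)"
    by (simp add: orient_def cross2_def algebra_simps)
  have nz: "cross2 (C - A) (D - B) \<noteq> 0"
    and area: "quad_area A B C D = \<bar>cross2 (C - A) (D - B)\<bar> / 2"
    using quad_area_uncrossed[OF uncrossed] by (simp_all add: diag)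
  obtain K where K: "hom_K r A B C D = K" "hom_L r A B C D = K + (1 - r) *\<^sub>R (C - A)"
    "hom_M r A B C D = K + (1 - r) *\<^sub>R (C - A) + (1 - r) *\<^sub>R (D - B)"
    "hom_N r A B C D = K + (1 - r) *\<^sub>R (D - B)"
    using hom_parallelogram[OF nz] .
  have scale: "cross2 ((1 - r) *\<^sub>R (C - A)) ((1 - r) *\<^sub>R (D - B)) = (r - 1)\<^sup>2 * cross2 (C - A) (D - B)"
    by (simp add: cross2_def power2_eq_square algebra_simps)
  show ?thesis
  proof (cases "r = 1")
    \<comment> \<open>All four vertices coincide with \<open>K\<close>, and both sides are
      0.\<close>
    case True
    then show ?thesis unfolding K by (simp add: quad_area_singleton)
  next
    case False
    then show ?thesis unfolding K area
      using nz by (subst quad_area_parallelogram) (simp_all add: scale abs_mult)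
  qed
qed

end
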